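(* Let $n\ge 3$ be an integer, and let $\mathcal S_{2n,3}$ denote the collection of subsets of size $3$ of the dihedral group $D_{2n}=\langle r,s\mid r^n,s^2,rsrs\rangle$ of order $2n$. Then $\mathcal S_{2n,3}$ has strictly more MSTD sets than MDTS sets.
   Context: For a subset $A$ of a (multiplicatively written) group, $A+A=\{a_1a_2:a_1,a_2\in A\}$ and $A-A=\{a_1a_2^{-1}:a_1,a_2\in A\}$. $A$ is MSTD (more sums than differences) if $|A+A|>|A-A|$, and MDTS (more differences than sums) if $|A+A|<|A-A|$. *)

theory Defs
  imports "HOL-Algebra.Coset"
begin

section \<open>Groups given by generators and relators\<close>

text \<open>
  The letter \<open>(g, True)\<close> stands for the generator \<open>g\<close> and \<open>(g, False)\<close> for its formal inverse.
\<close>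

type_synonym 'g word = "('g \<times> bool) list"

definition inv_letter :: "'g \<times> bool \<Rightarrow> 'g \<times> bool" where
  "inv_letter x = (fst x, \<not> snd x)"

text \<open>
  Two words are related iff they represent the same element of \<open>\<langle>'g | R\<rangle>\<close>, that is, iff one can be
  turned into the other by finitely many insertions and deletions of subwords \<open>x x\<^sup>-\<^sup>1\<close> and of
  relators from \<open>R\<close>.
\<close>

inductive pres_eq :: "'g word set \<Rightarrow> 'g word \<Rightarrow> 'g word \<Rightarrow> bool" for R where
  refl: "pres_eq R u u"
| sym: "pres_eq R u v \<Longrightarrow> pres_eq R v u"
| trans: "pres_eq R u v \<Longrightarrow> pres_eq R v w \<Longrightarrow> pres_eq R u w"
| cancel: "pres_eq R (u @ [x, inv_letter x] @ v) (u @ v)"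
| relator: "\<rho> \<in> R \<Longrightarrow> pres_eq R (u @ \<rho> @ v) (u @ v)"

definition pres_rel :: "'g word set \<Rightarrow> ('g word \<times> 'g word) set" where
  "pres_rel R = {(u, v). pres_eq R u v}"

definition presented_group :: "'g word set \<Rightarrow> 'g word set monoid" where
  "presented_group R =
    \<lparr>carrier = UNIV // pres_rel R,
     monoid.mult = (\<lambda>X Y. \<Union>u\<in>X. \<Union>v\<in>Y. pres_rel R `` {u @ v}),
     one = pres_rel R `` {[]}\<rparr>"

lemma equiv_pres_rel: "equiv UNIV (pres_rel R)"
  by (intro equivI) (auto simp: pres_rel_def refl_on_def sym_def trans_def
      intro: pres_eq.intros)

lemma pres_eq_append_left: "pres_eq R u v \<Longrightarrow> pres_eq R (w @ u) (w @ v)"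
proof (induction rule: pres_eq.induct)
  case (cancel u x v)
  show ?case using pres_eq.cancel[of R "w @ u" x v] by simp
next
  case (relator \<rho> u v)
  then show ?case using pres_eq.relator[of \<rho> R "w @ u" v] by simp
qed (auto intro: pres_eq.intros)

lemma pres_eq_append_right: "pres_eq R u v \<Longrightarrow> pres_eq R (u @ w) (v @ w)"
proof (induction rule: pres_eq.induct)
  case (cancel u x v)
  show ?case using pres_eq.cancel[of R u x "v @ w"] by simp
next
  case (relator \<rho> u v)
  then show ?case using pres_eq.relator[of \<rho> R u "v @ w"] by simp
qed (auto intro: pres_eq.intros)

lemma pres_eq_append: "pres_eq R u u' \<Longrightarrow> pres_eq R v v' \<Longrightarrow> pres_eq R (u @ v) (u' @ v')"
  by (meson pres_eq.trans pres_eq_append_left pres_eq_append_right)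

lemma presented_group_mult:
  "pres_rel R `` {u} \<otimes>\<^bsub>presented_group R\<^esub> pres_rel R `` {v} = pres_rel R `` {u @ v}"
proof -
  have "congruent2 (pres_rel R) (pres_rel R) (\<lambda>u v. pres_rel R `` {u @ v})"
    unfolding congruent2_def
    by clarsimp (rule equiv_class_eq[OF equiv_pres_rel], simp add: pres_rel_def pres_eq_append)
  from UN_equiv_class2[OF equiv_pres_rel equiv_pres_rel this]
  show ?thesis by (simp add: presented_group_def)
qed

lemma inv_letter_inv_letter [simp]: "inv_letter (inv_letter x) = x"
  by (simp add: inv_letter_def)

lemma pres_eq_left_inverse: "pres_eq R (map inv_letter (rev u) @ u) []"
proof (induction u)
  case (Cons x u)
  have "pres_eq R (map inv_letter (rev u) @ [inv_letter x, x] @ u) (map inv_letter (rev u) @ u)"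
    using pres_eq.cancel[of R "map inv_letter (rev u)" "inv_letter x" u] by simp
  then show ?case using Cons.IH by (auto intro: pres_eq.trans)
qed (auto intro: pres_eq.refl)

lemma group_presented_group: "group (presented_group R)"
proof (rule groupI)
  let ?G = "presented_group R"
  have carr: "carrier ?G = range (\<lambda>u. pres_rel R `` {u})"
    by (auto simp: presented_group_def quotient_def)
  have one: "\<one>\<^bsub>?G\<^esub> = pres_rel R `` {[]}"
    by (simp add: presented_group_def)
  show "X \<otimes>\<^bsub>?G\<^esub> Y \<in> carrier ?G" if "X \<in> carrier ?G" "Y \<in> carrier ?G" for X Y
    using that by (auto simp: carr presented_group_mult)
  show "\<one>\<^bsub>?G\<^esub> \<in> carrier ?G"
    by (simp add: carr one)
  show "X \<otimes>\<^bsub>?G\<^esub> Y \<otimes>\<^bsub>?G\<^esub> Z = X \<otimes>\<^bsub>?G\<^esub> (Y \<otimes>\<^bsub>?G\<^esub> Z)"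
    if "X \<in> carrier ?G" "Y \<in> carrier ?G" "Z \<in> carrier ?G" for X Y Z
    using that by (auto simp: carr presented_group_mult)
  show "\<one>\<^bsub>?G\<^esub> \<otimes>\<^bsub>?G\<^esub> X = X" if "X \<in> carrier ?G" for X
    using that by (auto simp: carr one presented_group_mult)
  show "\<exists>Y\<in>carrier ?G. Y \<otimes>\<^bsub>?G\<^esub> X = \<one>\<^bsub>?G\<^esub>" if X: "X \<in> carrier ?G" for X
  proof -
    obtain u where u: "X = pres_rel R `` {u}" using X carr by auto
    have "pres_rel R `` {map inv_letter (rev u)} \<otimes>\<^bsub>?G\<^esub> X = \<one>\<^bsub>?G\<^esub>"
      unfolding u one presented_group_mult
      by (intro equiv_class_eq[OF equiv_pres_rel]) (simp add: pres_rel_def pres_eq_left_inverse)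
    then show ?thesis unfolding carr by blast
  qed
qed


section \<open>The dihedral group\<close>

datatype dgen = Rot | Ref

text \<open>\<open>D\<^sub>2\<^sub>n = \<langle>r, s | r\<^sup>n, s\<^sup>2, rsrs\<rangle>\<close>; the parameter is \<open>n\<close>, half the order of the group.\<close>

definition dihedral_relators :: "nat \<Rightarrow> dgen word set" where
  "dihedral_relators n =
    (let r = (Rot, True); s = (Ref, True) in {replicate n r, [s, s], [r, s, r, s]})"

definition dihedral_group :: "nat \<Rightarrow> dgen word set monoid" where
  "dihedral_group n = presented_group (dihedral_relators n)"

lemma group_dihedral_group: "group (dihedral_group n)"
  by (simp add: dihedral_group_def group_presented_group)

text \<open>
  The pair \<open>(k, e)\<close> represents \<open>r\<^sup>k s\<^sup>e\<close>; \<open>dact\<close> is left multiplication by a letter.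
\<close>

fun dact :: "nat \<Rightarrow> dgen \<times> bool \<Rightarrow> int \<times> bool \<Rightarrow> int \<times> bool" where
  "dact n (Rot, b) (k, e) = ((if b then k + 1 else k - 1) mod int n, e)"
| "dact n (Ref, b) (k, e) = ((- k) mod int n, \<not> e)"

definition deval :: "nat \<Rightarrow> dgen word \<Rightarrow> int \<times> bool" where
  "deval n w = foldr (dact n) w (0, False)"

definition dword :: "int \<times> bool \<Rightarrow> dgen word" where
  "dword p = replicate (nat (fst p)) (Rot, True) @ (if snd p then [(Ref, True)] else [])"

lemma dact_range: "n > 0 \<Longrightarrow> dact n x p \<in> {0..<int n} \<times> UNIV"
  by (cases "(n, x, p)" rule: dact.cases) auto

lemma foldr_dact_range:
  "n > 0 \<Longrightarrow> p \<in> {0..<int n} \<times> UNIV \<Longrightarrow> foldr (dact n) w p \<in> {0..<int n} \<times> UNIV"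
  by (induction w) (use dact_range in auto)

lemma foldr_dact_rot:
  "n > 0 \<Longrightarrow> foldr (dact n) (replicate m (Rot, True)) (k mod int n, e) = ((k + int m) mod int n, e)"
  by (induction m) (auto simp: mod_simps algebra_simps)

lemma deval_pres_eq:
  assumes n: "n > 0" and "pres_eq (dihedral_relators n) u v"
  shows "deval n u = deval n v"
  using assms(2)
proof (induction rule: pres_eq.induct)
  case (cancel u x v)
  obtain k e where p: "deval n v = (k, e)" by fastforce
  have k: "k mod int n = k"
    using foldr_dact_range[OF n, of "(0, False)" v] n p by (auto simp: deval_def)
  have "dact n x (dact n (inv_letter x) (k, e)) = (k, e)"
    using k by (cases x; cases "fst x") (auto simp: inv_letter_def mod_simps)
  then show ?case using p by (simp add: deval_def)
next
  case (relator \<rho> u v)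
  obtain k e where p: "deval n v = (k, e)" by fastforce
  have k: "k mod int n = k"
    using foldr_dact_range[OF n, of "(0, False)" v] n p by (auto simp: deval_def)
  have "foldr (dact n) \<rho> (k, e) = (k, e)"
    using relator k foldr_dact_rot[OF n, of n k e]
    by (auto simp: dihedral_relators_def Let_def mod_simps)
  then show ?case using p by (simp add: deval_def)
qed auto

lemma deval_dword:
  assumes "n > 0" "p \<in> {0..<int n} \<times> UNIV"
  shows "deval n (dword p) = p"
proof -
  obtain k e where p: "p = (k, e)" by fastforce
  have "foldr (dact n) (if e then [(Ref, True)] else []) (0, False) = (0 mod int n, e)" by simp
  then have "deval n (dword p) = ((0 + int (nat k)) mod int n, e)"
    unfolding deval_def dword_def p
    using foldr_dact_rot[OF assms(1), of "nat k" 0 e] by (auto split: if_splits)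
  then show ?thesis using assms(2) p by auto
qed

lemma pres_eq_dword_deval:
  assumes n: "n > 0"
  shows "pres_eq (dihedral_relators n) w (dword (deval n w))"
proof -
  let ?R = "dihedral_relators n"
  define r where "r = (Rot, True)"
  define r' where "r' = (Rot, False)"
  define s where "s = (Ref, True)"
  define s' where "s' = (Ref, False)"
  note tr = pres_eq.trans[of ?R] and sy = pres_eq.sym[of ?R]
  have R: "replicate n r \<in> ?R" "[s, s] \<in> ?R" "[r, s, r, s] \<in> ?R"
    by (auto simp: dihedral_relators_def r_def s_def Let_def)
  have c1: "pres_eq ?R (u @ [r, r'] @ v) (u @ v)" for u v
    using pres_eq.cancel[of ?R u r v] by (simp add: r_def r'_def inv_letter_def)
  have c2: "pres_eq ?R (u @ [r', r] @ v) (u @ v)" for u v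
    using pres_eq.cancel[of ?R u r' v] by (simp add: r_def r'_def inv_letter_def)
  have c3: "pres_eq ?R (u @ [s', s] @ v) (u @ v)" for u v
    using pres_eq.cancel[of ?R u s' v] by (simp add: s_def s'_def inv_letter_def)
  have s': "pres_eq ?R (s' # v) (s # v)" for v
  proof -
    have "pres_eq ?R (s' # s # s # v) (s' # v)"
      using pres_eq.relator[OF R(2), of "[s']" v] by simp
    moreover have "pres_eq ?R (s' # s # s # v) (s # v)"
      using c3[of "[]" "s # v"] by simp
    ultimately show ?thesis by (meson tr sy)
  qed
  have rn: "pres_eq ?R (r' # v) (replicate (n - 1) r @ v)" for v
  proof -
    have "pres_eq ?R (r' # replicate n r @ v) (r' # v)"
      using pres_eq.relator[OF R(1), of "[r']" v] by simp
    moreover have "replicate n r = r # replicate (n - 1) r"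
      using n by (cases n) auto
    moreover have "pres_eq ?R (r' # r # replicate (n - 1) r @ v) (replicate (n - 1) r @ v)"
      using c2[of "[]" "replicate (n - 1) r @ v"] by simp
    ultimately show ?thesis by (metis append_Cons tr sy)
  qed
  have sr: "pres_eq ?R (s # r # v) (r' # s # v)" for v
  proof -
    have 1: "pres_eq ?R (r' # r # s # r # s # s # v) (r' # s # v)"
      using pres_eq.relator[OF R(3), of "[r']" "s # v"] by simp
    have 2: "pres_eq ?R (r' # r # s # r # s # s # v) (s # r # s # s # v)"
      using c2[of "[]" "s # r # s # s # v"] by simp
    have 3: "pres_eq ?R (s # r # s # s # v) (s # r # v)"
      using pres_eq.relator[OF R(2), of "[s, r]" v] by simp
    show ?thesis using 1 2 3 by (meson tr sy)
  qed
  have srk: "pres_eq ?R (s # replicate m r @ v) (replicate m r' @ s # v)" for m v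
  proof (induction m)
    case (Suc m)
    have "pres_eq ?R (s # r # replicate m r @ v) (r' # s # replicate m r @ v)" by (rule sr)
    moreover have "pres_eq ?R (r' # s # replicate m r @ v) (r' # replicate m r' @ s # v)"
      using pres_eq_append_left[OF Suc, of "[r']"] by simp
    ultimately show ?case by (auto intro: tr)
  qed (auto intro: pres_eq.refl)
  have rr: "pres_eq ?R (replicate m r' @ replicate m r @ v) v" for m v
  proof (induction m arbitrary: v)
    case (Suc m)
    have "pres_eq ?R (replicate m r' @ [r', r] @ replicate m r @ v)
            (replicate m r' @ replicate m r @ v)" by (rule c2)
    then show ?case using Suc[of v]
      by (auto simp: replicate_app_Cons_same intro: tr)
  qed (auto intro: pres_eq.refl)
  have rneg: "pres_eq ?R (replicate m r' @ v) (replicate (n - m) r @ v)" if "m \<le> n" for m v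
  proof -
    have "pres_eq ?R (replicate m r' @ replicate n r @ v) (replicate m r' @ v)"
      using pres_eq.relator[OF R(1), of "replicate m r'" v] by simp
    moreover have "replicate n r = replicate m r @ replicate (n - m) r"
      using that by (simp flip: replicate_add)
    moreover have "pres_eq ?R (replicate m r' @ replicate m r @ replicate (n - m) r @ v)
        (replicate (n - m) r @ v)" by (rule rr)
    ultimately show ?thesis by (metis append_assoc tr sy)
  qed
  have step: "pres_eq ?R (x # dword p) (dword (dact n x p))"
    if p0: "p \<in> {0..<int n} \<times> UNIV" for x p
  proof -
    obtain i e where "p = (i, e)" "0 \<le> i" "i < int n"
      using p0 by (cases p) auto
    then obtain k where p: "p = (int k, e)" and k: "k < n"
      by (metis nonneg_int_cases of_nat_less_iff)
    define t where "t = (if e then [s] else [])"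
    have dw: "dword p = replicate k r @ t" by (simp add: p dword_def r_def t_def s_def)
    consider "x = r" | "x = r'" | "x = s \<or> x = s'"
      by (cases x; cases "fst x"; cases "snd x") (auto simp: r_def r'_def s_def s'_def)
    then show ?thesis
    proof cases
      case 1
      show ?thesis
      proof (cases "k + 1 < n")
        case True
        then have "dword (dact n x p) = x # dword p"
          using 1 by (auto simp: p dword_def r_def nat_add_distrib)
        then show ?thesis by (simp add: pres_eq.refl)
      next
        case False
        then have nk: "n = Suc k" using k by simp
        have "dword (dact n x p) = t"
          using 1 by (simp add: p dword_def r_def t_def s_def nk add.commute)
        moreover have "pres_eq ?R (replicate n r @ t) t"
          using pres_eq.relator[OF R(1), of "[]" t] by simp
        ultimately show ?thesis using nk 1 dw by simp
      qed
    next
      case 2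
      show ?thesis
      proof (cases k)
        case 0
        have "(- 1) mod int n = int n - 1" using n by (simp add: zmod_minus1)
        then have "dword (dact n x p) = replicate (n - 1) r @ t"
          using 2 n 0 by (simp add: p dword_def r'_def r_def t_def s_def nat_diff_distrib)
        then show ?thesis using rn[of t] 0 2 dw by simp
      next
        case (Suc j)
        then have "dword (dact n x p) = replicate j r @ t"
          using 2 k by (simp add: p dword_def r'_def r_def t_def s_def)
        then show ?thesis using c2[of "[]" "replicate j r @ t"] Suc 2 dw by simp
      qed
    next
      case 3
      define t' where "t' = (if e then [] else [s])"
      have "pres_eq ?R (x # dword p) (s # replicate k r @ t)"
        using 3 s' dw by (auto intro: pres_eq.refl)
      moreover have "pres_eq ?R (s # replicate k r @ t) (replicate k r' @ s # t)" by (rule srk)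
      moreover have "pres_eq ?R (s # t) t'"
        using pres_eq.relator[OF R(2), of "[]" "[]"] by (auto simp: t_def t'_def intro: pres_eq.refl)
      then have "pres_eq ?R (replicate k r' @ s # t) (replicate k r' @ t')"
        by (rule pres_eq_append_left)
      moreover have "pres_eq ?R (replicate k r' @ t') (dword (dact n x p))"
      proof (cases "k = 0")
        case True
        then have "dword (dact n x p) = t'"
          using 3 by (auto simp: p dword_def s_def s'_def t'_def)
        then show ?thesis using True by (simp add: pres_eq.refl)
      next
        case False
        have "(- int k) mod int n = int (n - k)"
          using False k by (simp add: zmod_zminus1_eq_if of_nat_diff)
        then have "dword (dact n x p) = replicate (n - k) r @ t'"
          using 3 by (auto simp: p dword_def s_def s'_def t'_def r_def)
        then show ?thesis using rneg[of k t'] k by simp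
      qed
      ultimately show ?thesis by (meson tr)
    qed
  qed
  show ?thesis
  proof (induction w)
    case Nil
    show ?case by (simp add: deval_def dword_def pres_eq.refl)
  next
    case (Cons x w)
    have "pres_eq ?R (x # w) (x # dword (deval n w))"
      using pres_eq_append_left[OF Cons, of "[x]"] by simp
    moreover have "pres_eq ?R (x # dword (deval n w)) (dword (dact n x (deval n w)))"
      using step foldr_dact_range[OF n, of "(0, False)" w] n by (simp add: deval_def)
    moreover have "dact n x (deval n w) = deval n (x # w)" by (simp add: deval_def)
    ultimately show ?case by (metis tr)
  qed
qed

lemma order_dihedral_group:
  assumes n: "n > 0"
  shows "order (dihedral_group n) = 2 * n"
proof -
  let ?f = "\<lambda>p. pres_rel (dihedral_relators n) `` {dword p}"
  let ?P = "{0..<int n} \<times> (UNIV :: bool set)"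
  have eq: "pres_rel (dihedral_relators n) `` {u} = pres_rel (dihedral_relators n) `` {v} \<longleftrightarrow>
      pres_eq (dihedral_relators n) u v" for u v
    using eq_equiv_class_iff[OF equiv_pres_rel, of u v] by (simp add: pres_rel_def)
  have "inj_on ?f ?P"
    unfolding inj_on_def eq using deval_pres_eq[OF n] deval_dword[OF n] by metis
  moreover have "?f ` ?P = carrier (dihedral_group n)"
  proof
    show "?f ` ?P \<subseteq> carrier (dihedral_group n)"
      by (auto simp: dihedral_group_def presented_group_def quotient_def)
    show "carrier (dihedral_group n) \<subseteq> ?f ` ?P"
    proof
      fix X assume "X \<in> carrier (dihedral_group n)"
      then obtain w where "X = pres_rel (dihedral_relators n) `` {w}"
        by (auto simp: dihedral_group_def presented_group_def quotient_def)
      then have "X = ?f (deval n w)" using eq pres_eq_dword_deval[OF n] by simp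
      then show "X \<in> ?f ` ?P"
        using foldr_dact_range[OF n, of "(0, False)" w] n unfolding deval_def by simp
    qed
  qed
  ultimately have "card (carrier (dihedral_group n)) = card ?P"
    by (metis card_image)
  then show ?thesis by (simp add: order_def card_cartesian_product)
qed


section \<open>MSTD and MDTS sets\<close>

text \<open>
  The sets \<open>A + A\<close> and \<open>A - A\<close> of a multiplicatively written group. Comparing them via
  \<^const>\<open>card\<close> is meaningful only for finite \<open>A\<close>.
\<close>

definition sum_set :: "('a, 'b) monoid_scheme \<Rightarrow> 'a set \<Rightarrow> 'a set" where
  "sum_set G A = {a\<^sub>1 \<otimes>\<^bsub>G\<^esub> a\<^sub>2 | a\<^sub>1 a\<^sub>2. a\<^sub>1 \<in> A \<and> a\<^sub>2 \<in> A}"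

definition diff_set :: "('a, 'b) monoid_scheme \<Rightarrow> 'a set \<Rightarrow> 'a set" where
  "diff_set G A = {a\<^sub>1 \<otimes>\<^bsub>G\<^esub> inv\<^bsub>G\<^esub> a\<^sub>2 | a\<^sub>1 a\<^sub>2. a\<^sub>1 \<in> A \<and> a\<^sub>2 \<in> A}"

definition MSTD :: "('a, 'b) monoid_scheme \<Rightarrow> 'a set \<Rightarrow> bool" where
  "MSTD G A \<longleftrightarrow> card (sum_set G A) > card (diff_set G A)"

definition MDTS :: "('a, 'b) monoid_scheme \<Rightarrow> 'a set \<Rightarrow> bool" where
  "MDTS G A \<longleftrightarrow> card (sum_set G A) < card (diff_set G A)"

definition subsets_of_size :: "('a, 'b) monoid_scheme \<Rightarrow> nat \<Rightarrow> 'a set set" where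
  "subsets_of_size G m = {A. A \<subseteq> carrier G \<and> card A = m}"

end

theory Submission
  imports Defs
begin

text \<open>
  Write a set \<open>A\<close> of dihedral elements as \<open>X \<union> Y s\<close> with \<open>X, Y\<close> sets of rotations.  Rotations
  commute, reflections are involutions, and \<open>s x = x\<^sup>-\<^sup>1 s\<close>, so
  \<open>A + A = (X X \<union> Y Y\<^sup>-\<^sup>1) \<union> (X Y \<union> Y X\<^sup>-\<^sup>1) s\<close> and \<open>A - A = (X X\<^sup>-\<^sup>1 \<union> Y Y\<^sup>-\<^sup>1) \<union> (X Y) s\<close>.
  The reflections of \<open>A - A\<close> all occur in \<open>A + A\<close>, and differences can win only through \<open>X X\<^sup>-\<^sup>1\<close>.
  Let \<open>A\<close> have three elements, at least one of them a reflection.  If \<open>X\<close> has at most one element,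
  then \<open>X X\<^sup>-\<^sup>1 \<subseteq> {1} \<subseteq> Y Y\<^sup>-\<^sup>1\<close>, so \<open>A - A \<subseteq> A + A\<close>.  Otherwise \<open>X = {x, y}\<close> and \<open>Y\<close> is a
  singleton, and then \<open>X X = x y \<cdot> X X\<^sup>-\<^sup>1\<close>, so multiplying the rotations of \<open>A - A\<close> by \<open>x y\<close>
  and fixing its reflections embeds \<open>A - A\<close> in \<open>A + A\<close>.
  Hence an MDTS set of size three consists of rotations only (\<open>MDTS_only_rotations\<close>).

  It remains to find more MSTD sets than there are triples of rotations.  The embedding just
  described misses a reflection of \<open>A + A\<close> unless \<open>x y = 1\<close> or \<open>x\<^sup>2 = y\<^sup>2 = 1\<close>
  (\<open>MSTD_two_rotations_one_reflection\<close>).  As \<open>x\<^sup>2 = 1\<close> has at most two solutions among the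
  rotations, no rotation lies in two such exceptional pairs, so every triple of rotations contains
  a pair that is not exceptional (\<open>ex_unexceptional_pair\<close>).  Multiplying the third element of
  the triple by \<open>s\<close> gives an MSTD set, from which the triple is recovered by multiplying the
  reflections by \<open>s\<close> again.  The MSTD set \<open>{1, r, s}\<close> is not obtained in this way, as undoing
  the multiplication makes \<open>1\<close> and \<open>s\<close> collide; so MSTD sets are strictly more numerous.
\<close>

section \<open>Rotations and reflections\<close>

definition rotation :: "nat \<Rightarrow> int \<Rightarrow> dgen word set" where
  "rotation n k = pres_rel (dihedral_relators n) `` {dword (k mod int n, False)}"

definition reflection :: "nat \<Rightarrow> int \<Rightarrow> dgen word set" where
  "reflection n k = pres_rel (dihedral_relators n) `` {dword (k mod int n, True)}"

lemma pres_rel_class_eq_iff: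
  "pres_rel R `` {u} = pres_rel R `` {v} \<longleftrightarrow> pres_eq R u v"
  using eq_equiv_class_iff[OF equiv_pres_rel, of u v] by (simp add: pres_rel_def)

lemma class_dword_eq_iff:
  assumes "n > 0"
  shows "pres_rel (dihedral_relators n) `` {dword (i mod int n, d)} =
      pres_rel (dihedral_relators n) `` {dword (j mod int n, e)} \<longleftrightarrow> int n dvd i - j \<and> d = e"
proof -
  have "deval n (dword (i mod int n, d)) = (i mod int n, d)"
    "deval n (dword (j mod int n, e)) = (j mod int n, e)"
    using assms by (simp_all add: deval_dword)
  then have "pres_eq (dihedral_relators n) (dword (i mod int n, d)) (dword (j mod int n, e)) \<longleftrightarrow>
      (i mod int n, d) = (j mod int n, e)"
    by (metis deval_pres_eq[OF assms] pres_eq.refl)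
  then show ?thesis by (simp add: pres_rel_class_eq_iff mod_eq_dvd_iff)
qed

lemma rotation_eq_iff: "n > 0 \<Longrightarrow> rotation n i = rotation n j \<longleftrightarrow> int n dvd i - j"
  and reflection_eq_iff: "n > 0 \<Longrightarrow> reflection n i = reflection n j \<longleftrightarrow> int n dvd i - j"
  and rotation_neq_reflection:
    "n > 0 \<Longrightarrow> rotation n i \<noteq> reflection n j" "n > 0 \<Longrightarrow> reflection n i \<noteq> rotation n j"
  by (simp_all add: rotation_def reflection_def class_dword_eq_iff)

lemma deval_dword_append:
  assumes "n > 0"
  shows "deval n (dword (i mod int n, d) @ dword (j mod int n, e)) =
    ((if d then i - j else i + j) mod int n, d \<noteq> e)"
proof -
  have "deval n (dword (j mod int n, e)) = (j mod int n, e)"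
    using assms by (simp add: deval_dword)
  then have "foldr (dact n) (if d then [(Ref, True)] else []) (deval n (dword (j mod int n, e))) =
      ((if d then - j else j) mod int n, d \<noteq> e)"
    by (simp add: mod_simps)
  moreover have "int (nat (i mod int n)) = i mod int n"
    using assms by simp
  ultimately show ?thesis
    using foldr_dact_rot[OF assms, of "nat (i mod int n)" "if d then - j else j" "d \<noteq> e"]
    unfolding deval_def dword_def foldr_append fst_conv snd_conv
    by (auto simp: mod_simps add.commute)
qed

lemma mult_class_dword:
  assumes "n > 0"
  shows "pres_rel (dihedral_relators n) `` {dword (i mod int n, d)} \<otimes>\<^bsub>dihedral_group n\<^esub>
      pres_rel (dihedral_relators n) `` {dword (j mod int n, e)} =
    pres_rel (dihedral_relators n) `` {dword ((if d then i - j else i + j) mod int n, d \<noteq> e)}"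
  using pres_eq_dword_deval[OF assms, of "dword (i mod int n, d) @ dword (j mod int n, e)"]
  by (simp add: dihedral_group_def presented_group_mult pres_rel_class_eq_iff
      deval_dword_append[OF assms])

lemma dihedral_mult:
  assumes "n > 0"
  shows "rotation n i \<otimes>\<^bsub>dihedral_group n\<^esub> rotation n j = rotation n (i + j)"
    and "rotation n i \<otimes>\<^bsub>dihedral_group n\<^esub> reflection n j = reflection n (i + j)"
    and "reflection n i \<otimes>\<^bsub>dihedral_group n\<^esub> rotation n j = reflection n (i - j)"
    and "reflection n i \<otimes>\<^bsub>dihedral_group n\<^esub> reflection n j = rotation n (i - j)"
  unfolding rotation_def reflection_def mult_class_dword[OF assms] by simp_all

lemma carrier_dihedral_group:
  assumes "n > 0"
  shows "carrier (dihedral_group n) = range (rotation n) \<union> range (reflection n)"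
proof
  show "range (rotation n) \<union> range (reflection n) \<subseteq> carrier (dihedral_group n)"
    by (auto simp: rotation_def reflection_def dihedral_group_def presented_group_def quotient_def)
  show "carrier (dihedral_group n) \<subseteq> range (rotation n) \<union> range (reflection n)"
  proof
    fix X assume "X \<in> carrier (dihedral_group n)"
    then obtain w where X: "X = pres_rel (dihedral_relators n) `` {w}"
      by (auto simp: dihedral_group_def presented_group_def quotient_def)
    obtain k e where ke: "deval n w = (k, e)" by fastforce
    have "k mod int n = k"
      using foldr_dact_range[OF assms, of "(0, False)" w] assms ke by (auto simp: deval_def)
    then have "X = pres_rel (dihedral_relators n) `` {dword (k mod int n, e)}"
      using pres_eq_dword_deval[OF assms, of w] ke X by (simp add: pres_rel_class_eq_iff)
    then show "X \<in> range (rotation n) \<union> range (reflection n)"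
      by (cases e) (auto simp: rotation_def reflection_def)
  qed
qed

lemma finite_carrier_dihedral_group: "n > 0 \<Longrightarrow> finite (carrier (dihedral_group n))"
  using order_dihedral_group[of n] by (intro card_ge_0_finite) (simp add: order_def)

lemma dihedral_one:
  assumes "n > 0"
  shows "\<one>\<^bsub>dihedral_group n\<^esub> = rotation n 0"
  using assms by (simp add: rotation_def dihedral_group_def presented_group_def dword_def)

lemma inv_rotation:
  assumes "n > 0"
  shows "inv\<^bsub>dihedral_group n\<^esub> rotation n i = rotation n (- i)"
proof -
  interpret group "dihedral_group n" by (rule group_dihedral_group)
  show ?thesis
    using dihedral_one[OF assms] assms by (intro inv_equality) (auto simp: dihedral_mult carrier_dihedral_group)
qed

lemma inv_reflection:
  assumes "n > 0"
  shows "inv\<^bsub>dihedral_group n\<^esub> reflection n i = reflection n i"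
proof -
  interpret group "dihedral_group n" by (rule group_dihedral_group)
  show ?thesis
    using dihedral_one[OF assms] assms by (intro inv_equality) (auto simp: dihedral_mult carrier_dihedral_group)
qed


section \<open>Sums and differences of sets containing a reflection\<close>

lemma finite_sum_set: "finite A \<Longrightarrow> finite (sum_set G A)"
proof -
  assume "finite A"
  then have "finite ((\<lambda>(x, y). x \<otimes>\<^bsub>G\<^esub> y) ` (A \<times> A))" by simp
  moreover have "sum_set G A = (\<lambda>(x, y). x \<otimes>\<^bsub>G\<^esub> y) ` (A \<times> A)"
    by (auto simp: sum_set_def)
  ultimately show ?thesis by simp
qed

text \<open>
  Dividing by a reflection is multiplying by it, and dividing a reflection \<open>t\<close> by a rotation \<open>x\<close>
  gives \<open>t x\<^sup>-\<^sup>1 = x t\<close>.  The only other differences are quotients of two rotations; with a single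
  rotation available this quotient is \<open>1\<close>, which is also the square of a reflection.
\<close>

lemma diff_set_subset_sum_set:
  assumes n: "n > 0" and A: "A \<subseteq> insert (rotation n a) (range (reflection n))"
    and c: "reflection n c \<in> A"
  shows "diff_set (dihedral_group n) A \<subseteq> sum_set (dihedral_group n) A"
proof
  let ?G = "dihedral_group n"
  have sum: "u \<otimes>\<^bsub>?G\<^esub> v \<in> sum_set ?G A" if "u \<in> A" "v \<in> A" for u v
    using that by (auto simp: sum_set_def)
  fix z assume "z \<in> diff_set ?G A"
  then obtain u v where uv: "u \<in> A" "v \<in> A" and z: "z = u \<otimes>\<^bsub>?G\<^esub> inv\<^bsub>?G\<^esub> v"
    by (auto simp: diff_set_def)
  consider "v \<in> range (reflection n)" | "u = rotation n a" "v = rotation n a"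
    | j where "u = reflection n j" "v = rotation n a"
    using uv A by blast
  then show "z \<in> sum_set ?G A"
  proof cases
    case 1
    then show ?thesis using sum[OF uv] z n by (auto simp: inv_reflection)
  next
    case 2
    then show ?thesis using sum[OF c c] z n by (simp add: inv_rotation dihedral_mult)
  next
    case 3
    then show ?thesis
      using sum[OF uv(2) uv(1)] z n by (simp add: inv_rotation dihedral_mult add.commute)
  qed
qed

lemma sum_set_two_rotations_one_reflection:
  assumes "n > 0"
  shows "sum_set (dihedral_group n) {rotation n a, rotation n b, reflection n c} =
    {rotation n (a + a), rotation n (a + b), rotation n (b + b), rotation n 0,
     reflection n (a + c), reflection n (b + c), reflection n (c - a), reflection n (c - b)}"
proof -
  have "sum_set G {x, y, z} = {x \<otimes>\<^bsub>G\<^esub> x, x \<otimes>\<^bsub>G\<^esub> y, x \<otimes>\<^bsub>G\<^esub> z, y \<otimes>\<^bsub>G\<^esub> x, y \<otimes>\<^bsub>G\<^esub> y, y \<otimes>\<^bsub>G\<^esub> z,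
      z \<otimes>\<^bsub>G\<^esub> x, z \<otimes>\<^bsub>G\<^esub> y, z \<otimes>\<^bsub>G\<^esub> z}" for G :: "dgen word set monoid" and x y z
    by (auto simp: sum_set_def)
  then show ?thesis
    using assms by (simp add: dihedral_mult add.commute[of b a] insert_commute)
qed

lemma diff_set_two_rotations_one_reflection:
  assumes "n > 0"
  shows "diff_set (dihedral_group n) {rotation n a, rotation n b, reflection n c} =
    {rotation n (a - b), rotation n 0, rotation n (b - a),
     reflection n (a + c), reflection n (b + c)}"
proof -
  have "diff_set G {x, y, z} = {x \<otimes>\<^bsub>G\<^esub> inv\<^bsub>G\<^esub> x, x \<otimes>\<^bsub>G\<^esub> inv\<^bsub>G\<^esub> y, x \<otimes>\<^bsub>G\<^esub> inv\<^bsub>G\<^esub> z,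
      y \<otimes>\<^bsub>G\<^esub> inv\<^bsub>G\<^esub> x, y \<otimes>\<^bsub>G\<^esub> inv\<^bsub>G\<^esub> y, y \<otimes>\<^bsub>G\<^esub> inv\<^bsub>G\<^esub> z,
      z \<otimes>\<^bsub>G\<^esub> inv\<^bsub>G\<^esub> x, z \<otimes>\<^bsub>G\<^esub> inv\<^bsub>G\<^esub> y, z \<otimes>\<^bsub>G\<^esub> inv\<^bsub>G\<^esub> z}"
    for G :: "dgen word set monoid" and x y z
    by (auto simp: diff_set_def)
  then show ?thesis
    using assms
    by (simp add: dihedral_mult inv_rotation inv_reflection add.commute[of c] insert_commute)
qed

text \<open>
  Multiplying its rotations by \<open>r\<^bsup>a+b\<^esup>\<close> and fixing its reflections embeds the difference set in
  the sum set, because \<open>a - b\<close>, \<open>0\<close>, \<open>b - a\<close> are translated to \<open>a + a\<close>, \<open>a + b\<close>, \<open>b + b\<close>.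
\<close>

lemma card_diff_set_two_rotations_one_reflection:
  assumes n: "n > 0"
  shows "card (diff_set (dihedral_group n) {rotation n a, rotation n b, reflection n c}) =
    card {rotation n (a + a), rotation n (a + b), rotation n (b + b),
      reflection n (a + c), reflection n (b + c)}"
proof -
  let ?D = "diff_set (dihedral_group n) {rotation n a, rotation n b, reflection n c}"
  define g where "g x = (if x \<in> range (rotation n)
    then rotation n (a + b) \<otimes>\<^bsub>dihedral_group n\<^esub> x else x)" for x
  have g: "g (rotation n i) = rotation n (a + b + i)" "g (reflection n i) = reflection n i" for i
    using n rotation_neq_reflection[OF n] by (auto simp: g_def dihedral_mult)
  have "inj_on g (range (rotation n) \<union> range (reflection n))"
    using n by (simp add: inj_on_def ball_Un g rotation_eq_iff reflection_eq_iff
        rotation_neq_reflection)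
  then have "inj_on g ?D"
    by (rule inj_on_subset) (auto simp: diff_set_two_rotations_one_reflection[OF n])
  moreover have "g ` ?D = {rotation n (a + a), rotation n (a + b), rotation n (b + b),
      reflection n (a + c), reflection n (b + c)}"
    by (simp add: diff_set_two_rotations_one_reflection[OF n] g)
  ultimately show ?thesis by (metis card_image)
qed

lemma not_MDTS_two_rotations_one_reflection:
  assumes n: "n > 0"
  shows "\<not> MDTS (dihedral_group n) {rotation n a, rotation n b, reflection n c}"
proof -
  have "card (diff_set (dihedral_group n) {rotation n a, rotation n b, reflection n c})
      \<le> card (sum_set (dihedral_group n) {rotation n a, rotation n b, reflection n c})"
    unfolding card_diff_set_two_rotations_one_reflection[OF n]
    by (intro card_mono finite_sum_set)
      (simp_all add: sum_set_two_rotations_one_reflection[OF n])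
  then show ?thesis by (simp add: MDTS_def)
qed

text \<open>
  The sums \<open>s\<^sub>c r\<^sup>a\<close> and \<open>s\<^sub>c r\<^sup>b\<close>, where \<open>s\<^sub>c = r\<^sup>c s\<close>, are the reflections with exponents \<open>c - a\<close> and
  \<open>c - b\<close>.  The first avoids the exponents \<open>a + c\<close>, \<open>b + c\<close> of the embedded difference set exactly
  if neither \<open>2 a\<close> nor \<open>a + b\<close> vanishes modulo \<open>n\<close>, and symmetrically for the second.
\<close>

lemma MSTD_two_rotations_one_reflection:
  assumes n: "n > 0" and ab: "\<not> int n dvd a + b" and sq: "\<not> (int n dvd 2 * a \<and> int n dvd 2 * b)"
  shows "MSTD (dihedral_group n) {rotation n a, rotation n b, reflection n c}"
proof -
  let ?S = "sum_set (dihedral_group n) {rotation n a, rotation n b, reflection n c}"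
  let ?B = "{rotation n (a + a), rotation n (a + b), rotation n (b + b),
      reflection n (a + c), reflection n (b + c)}"
  have "reflection n (c - a) \<notin> ?B" if "\<not> int n dvd 2 * a"
  proof -
    have "reflection n (c - a) \<noteq> reflection n (a + c)"
      using that dvd_minus_iff[of "int n" "2 * a"] n by (simp add: reflection_eq_iff)
    moreover have "reflection n (c - a) \<noteq> reflection n (b + c)"
      using ab dvd_minus_iff[of "int n" "a + b"] n by (simp add: reflection_eq_iff algebra_simps)
    ultimately show ?thesis using n by (simp add: rotation_neq_reflection)
  qed
  moreover have "reflection n (c - b) \<notin> ?B" if "\<not> int n dvd 2 * b"
  proof -
    have "reflection n (c - b) \<noteq> reflection n (b + c)"
      using that dvd_minus_iff[of "int n" "2 * b"] n by (simp add: reflection_eq_iff)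
    moreover have "reflection n (c - b) \<noteq> reflection n (a + c)"
      using ab dvd_minus_iff[of "int n" "a + b"] n by (simp add: reflection_eq_iff algebra_simps)
    ultimately show ?thesis using n by (simp add: rotation_neq_reflection)
  qed
  moreover have "reflection n (c - a) \<in> ?S" "reflection n (c - b) \<in> ?S"
    by (simp_all add: sum_set_two_rotations_one_reflection[OF n])
  ultimately have "?B \<noteq> ?S"
    using sq by metis
  moreover have "?B \<subseteq> ?S"
    by (simp add: sum_set_two_rotations_one_reflection[OF n])
  ultimately have "?B \<subset> ?S"
    by blast
  then have "card ?B < card ?S"
    by (intro psubset_card_mono finite_sum_set) simp_all
  then show ?thesis
    by (simp add: MSTD_def card_diff_set_two_rotations_one_reflection[OF n])
qed

text \<open>
  A reflection in \<open>A\<close> leaves room for at most two rotations, so that one of the two comparisons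
  above applies.
\<close>

lemma MDTS_only_rotations:
  assumes n: "n > 0" and A: "A \<in> subsets_of_size (dihedral_group n) 3"
    and mdts: "MDTS (dihedral_group n) A"
  shows "A \<subseteq> range (rotation n)"
proof (rule ccontr)
  assume "\<not> A \<subseteq> range (rotation n)"
  have sub: "A \<subseteq> range (rotation n) \<union> range (reflection n)" and A3: "card A = 3"
    using A n by (auto simp: subsets_of_size_def carrier_dihedral_group)
  then have finA: "finite A" by (metis card.infinite zero_neq_numeral)
  obtain c where c: "reflection n c \<in> A"
    using \<open>\<not> A \<subseteq> range (rotation n)\<close> sub by blast
  show False
  proof (cases "\<exists>a. A \<subseteq> insert (rotation n a) (range (reflection n))")
    case True
    then have "diff_set (dihedral_group n) A \<subseteq> sum_set (dihedral_group n) A"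
      using diff_set_subset_sum_set[OF n _ c] by blast
    from card_mono[OF finite_sum_set[OF finA] this] show False
      using mdts by (simp add: MDTS_def)
  next
    case False
    then obtain a where a: "rotation n a \<in> A" using sub by blast
    obtain b where b: "rotation n b \<in> A" "rotation n a \<noteq> rotation n b"
      using False sub by blast
    have "{rotation n a, rotation n b, reflection n c} = A"
    proof (rule card_subset_eq)
      show "card {rotation n a, rotation n b, reflection n c} = card A"
        using A3 b rotation_neq_reflection[OF n] by simp
    qed (use finA a b c in simp_all)
    then show False
      using mdts not_MDTS_two_rotations_one_reflection[OF n, of a b c] by simp
  qed
qed


section \<open>Comparing the numbers of MSTD and MDTS sets\<close>

text \<open>
  Both \<open>x\<close> and \<open>y\<close> are odd multiples of \<open>m / 2\<close>, and two such numbers differ by a multiple of \<open>m\<close>.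
  So a cyclic group has at most one element of order two.
\<close>

lemma double_dvd_unique:
  fixes m x y :: int
  assumes "m dvd 2 * x" "m dvd 2 * y" "\<not> m dvd x" "\<not> m dvd y"
  shows "m dvd x - y"
proof -
  obtain k l where k: "2 * x = m * k" and l: "2 * y = m * l"
    using assms(1,2) unfolding dvd_def by blast
  have "odd k"
  proof
    assume "even k"
    then obtain t where "k = 2 * t" ..
    with k have "x = m * t" by simp
    with assms(3) show False by simp
  qed
  moreover have "odd l"
  proof
    assume "even l"
    then obtain t where "l = 2 * t" ..
    with l have "y = m * t" by simp
    with assms(4) show False by simp
  qed
  ultimately have "even (k - l)" by simp
  then obtain t where "k - l = 2 * t" ..
  moreover have "2 * (x - y) = m * (k - l)"
    using k l by (simp add: right_diff_distrib)
  ultimately have "x - y = m * t" by simp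
  then show ?thesis by simp
qed

text \<open>
  Call \<open>{a, b}\<close> exceptional if \<open>a + b = 0\<close> or \<open>2 a = 2 b = 0\<close> modulo \<open>m\<close>.  If \<open>{a, b}\<close> and
  \<open>{a, c}\<close> were both exceptional, then \<open>b\<close> and \<open>c\<close> would both be \<open>- a\<close>, or one of them would be
  \<open>- a = a\<close>, or \<open>a, b, c\<close> would be three different solutions of \<open>2 x = 0\<close>; none of this is possible.
\<close>

lemma ex_unexceptional_pair:
  fixes m a b c :: int
  assumes "\<not> m dvd a - b" "\<not> m dvd a - c" "\<not> m dvd b - c"
  shows "(\<not> m dvd a + b \<and> \<not> (m dvd 2 * a \<and> m dvd 2 * b)) \<or>
    (\<not> m dvd a + c \<and> \<not> (m dvd 2 * a \<and> m dvd 2 * c))"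
proof (rule ccontr)
  assume exc: "\<not> ?thesis"
  have 1: "\<not> (m dvd a + b \<and> m dvd a + c)"
    using assms(3) dvd_diff[of m "a + b" "a + c"] by auto
  have 2: "\<not> (m dvd a + b \<and> m dvd 2 * a)"
    using assms(1) dvd_diff[of m "2 * a" "a + b"] by auto
  have 3: "\<not> (m dvd a + c \<and> m dvd 2 * a)"
    using assms(2) dvd_diff[of m "2 * a" "a + c"] by auto
  have 4: "\<not> (m dvd 2 * a \<and> m dvd 2 * b \<and> m dvd 2 * c)"
  proof
    assume h: "m dvd 2 * a \<and> m dvd 2 * b \<and> m dvd 2 * c"
    have "m dvd (a - c) - (a - b)"
      using h assms(1,2) by (intro double_dvd_unique) (simp_all add: right_diff_distrib)
    then show False using assms(3) by simp
  qed
  show False using exc 1 2 3 4 by blast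
qed

text \<open>
  The witness is the triple itself with one rotation \<open>r\<^sup>k\<close> turned into the reflection \<open>r\<^sup>k s\<close>, where
  the remaining two form a pair that is not exceptional.
\<close>

lemma rotation_triple_from_MSTD:
  assumes n: "n > 0" and T: "T \<in> subsets_of_size (dihedral_group n) 3" "T \<subseteq> range (rotation n)"
  shows "\<exists>a b c. T = {rotation n a, rotation n b, rotation n c} \<and>
    {rotation n a, rotation n b, reflection n c} \<in> subsets_of_size (dihedral_group n) 3 \<and>
    MSTD (dihedral_group n) {rotation n a, rotation n b, reflection n c}"
proof -
  obtain x y z where xyz: "T = {x, y, z}" "x \<noteq> y" "x \<noteq> z" "y \<noteq> z"
    using T(1) by (auto simp: subsets_of_size_def card_3_iff)
  then obtain a b c where abc: "x = rotation n a" "y = rotation n b" "z = rotation n c"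
    using T(2) by auto
  have size: "{u, v, reflection n k} \<in> subsets_of_size (dihedral_group n) 3"
    if uv: "u \<in> T" "v \<in> T" "u \<noteq> v" for u v k
  proof -
    obtain i j where "u = rotation n i" "v = rotation n j"
      using uv T(2) by blast
    then show ?thesis
      using \<open>u \<noteq> v\<close> n by (simp add: subsets_of_size_def carrier_dihedral_group
          rangeI rotation_neq_reflection)
  qed
  have "\<not> int n dvd a - b" "\<not> int n dvd a - c" "\<not> int n dvd b - c"
    using xyz(2-4) rotation_eq_iff[OF n] abc by simp_all
  from ex_unexceptional_pair[OF this] show ?thesis
  proof
    assume "\<not> int n dvd a + b \<and> \<not> (int n dvd 2 * a \<and> int n dvd 2 * b)"
    then have "MSTD (dihedral_group n) {rotation n a, rotation n b, reflection n c}"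
      using MSTD_two_rotations_one_reflection[OF n] by blast
    moreover have "{rotation n a, rotation n b, reflection n c}
        \<in> subsets_of_size (dihedral_group n) 3"
      using size[of x y c] xyz abc by simp
    ultimately show ?thesis
      using xyz(1) abc by blast
  next
    assume "\<not> int n dvd a + c \<and> \<not> (int n dvd 2 * a \<and> int n dvd 2 * c)"
    then have "MSTD (dihedral_group n) {rotation n a, rotation n c, reflection n b}"
      using MSTD_two_rotations_one_reflection[OF n] by blast
    moreover have "T = {rotation n a, rotation n c, rotation n b}"
      using xyz(1) abc by (simp add: insert_commute)
    moreover have "{rotation n a, rotation n c, reflection n b}
        \<in> subsets_of_size (dihedral_group n) 3"
      using size[of x z b] xyz abc by simp
    ultimately show ?thesis by blast
  qed
qed

theorem lemma2p2:
  fixes n :: nat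
  assumes "n \<ge> 3"
  shows "card {A \<in> subsets_of_size (dihedral_group n) 3. MSTD (dihedral_group n) A}
       > card {A \<in> subsets_of_size (dihedral_group n) 3. MDTS (dihedral_group n) A}"
proof -
  let ?G = "dihedral_group n"
  define P where "P = {A \<in> subsets_of_size ?G 3. MSTD ?G A}"
  define Q where "Q = {A \<in> subsets_of_size ?G 3. MDTS ?G A}"
  have n: "n > 0" using assms by simp
  have finP: "finite P"
  proof (rule finite_subset)
    show "P \<subseteq> Pow (carrier ?G)" by (auto simp: P_def subsets_of_size_def)
  qed (use finite_carrier_dihedral_group[OF n] in simp)
  \<comment> \<open>Turns \<open>r\<^sup>k s\<close> back into \<open>r\<^sup>k\<close> by multiplying with \<open>s\<close>.\<close>
  define untwist where
    "untwist x = (if x \<in> range (rotation n) then x else x \<otimes>\<^bsub>?G\<^esub> reflection n 0)" for x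
  have untwist: "untwist (rotation n i) = rotation n i" "untwist (reflection n i) = rotation n i"
    for i
    using n rotation_neq_reflection[OF n] by (auto simp: untwist_def dihedral_mult)
  define E where "E = {rotation n 0, rotation n 1, reflection n 0}"
  have "\<not> int n dvd 1" "\<not> int n dvd 2"
    using assms zdvd_imp_le[of "int n" 1] zdvd_imp_le[of "int n" 2] by auto
  then have "MSTD ?G E"
    unfolding E_def using n by (intro MSTD_two_rotations_one_reflection) auto
  moreover have "E \<subseteq> carrier ?G"
    unfolding E_def carrier_dihedral_group[OF n] by blast
  moreover have "card E = 3"
    using \<open>\<not> int n dvd 1\<close> n by (simp add: E_def rotation_eq_iff rotation_neq_reflection)
  ultimately have E: "E \<in> P" by (simp add: P_def subsets_of_size_def)
  have "untwist ` E = {rotation n 0, rotation n 1}"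
    by (simp add: E_def untwist insert_commute)
  then have E2: "card (untwist ` E) \<noteq> 3"
    by (simp add: card_insert_if)
  have "Q \<subseteq> (image untwist) ` (P - {E})"
  proof
    fix T assume "T \<in> Q"
    then have T: "T \<in> subsets_of_size ?G 3" and "MDTS ?G T"
      by (simp_all add: Q_def)
    obtain a b c where abc: "T = {rotation n a, rotation n b, rotation n c}"
      and P: "{rotation n a, rotation n b, reflection n c} \<in> P" (is "?A \<in> P")
      using rotation_triple_from_MSTD[OF n T MDTS_only_rotations[OF n T \<open>MDTS ?G T\<close>]]
      unfolding P_def mem_Collect_eq by metis
    have TA: "T = untwist ` ?A" by (simp add: abc untwist)
    have "card T = 3" using T by (simp add: subsets_of_size_def)
    then have "?A \<noteq> E" using E2 TA by metis
    then show "T \<in> (image untwist) ` (P - {E})" using P TA by blast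
  qed
  then have "card Q \<le> card (P - {E})"
    using finP by (meson finite_Diff surj_card_le)
  also have "\<dots> < card P"
    using finP E by (rule card_Diff1_less)
  finally show ?thesis by (simp add: P_def Q_def)
qed

end
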